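(* Let $N\in\mathbb N$, $R_x\ge0$, let $\mathcal F(\mathbb R^d)$ be a class of closed, convex and proper functions whose interpolation conditions are encoded by $\{(A^{\mathrm{ic}}_k,a^{\mathrm{ic}}_k,b^{\mathrm{ic}}_k)\}_{k\in K_N}$, and let $(\{\tilde\alpha_k\},\{\tilde\beta_{i,j}\},\{\tilde\gamma_{i,j}\},\tilde\tau_x)$ be a feasible solution to problem (D) (defined in the context) that attains the objective value $\tilde\omega$. Then for any $(\mathcal F(\mathbb R^d),R_x)$-input $(f,x_0)$, if $x_1,\dots,x_N$ is a sequence that satisfies $$\Big\langle f'(x_i),\ \sum_{j=0}^{i-1}\tilde\beta_{i,j}f'(x_j)+\sum_{j=1}^{i}\tilde\gamma_{i,j}(x_j-x_0)\Big\rangle=0,\qquad i=1,\dots,N,$$ then the bound $f(x_N)-f_*\le\tilde\omega$ holds, for any choice of $f'(x_i)\in\partial f(x_i)$ (i.e. whatever subgradients $f'(x_i)\in\partial f(x_i)$, $0\le i\le N$, are the ones for which the equalities $\big\langle f'(x_i),\ \sum_{j=0}^{i-1}\tilde\beta_{i,j}f'(x_j)+\sum_{j=1}^{i}\tilde\gamma_{i,j}(x_j-x_0)\big\rangle=0$, $i=1,\dots,N$, hold).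
   Context: $\langle\cdot,\cdot\rangle$ and $\|\cdot\|$ are the Euclidean inner product and norm; $\mathbb N$ denotes the positive integers; $I^*_N:=\{*,0,1,\dots,N\}$; $f_*:=\min f$. $x\odot y:=\tfrac12(xy^\top+yx^\top)$. For a square matrix $M$, $M\succeq0$ means $v^\top Mv\ge0$ for all $v$. $(f,x_0)$ is an $(\mathcal F(\mathbb R^d),R_x)$-input if $f\in\mathcal F(\mathbb R^d)$, $x_0\in\mathbb R^d$, and $\|x_0-x_*\|\le R_x$ for some $x_*\in\operatorname{argmin}f$. A set $\{(x_i,g_i,f_i)\}_{i\in I}$ is $\mathcal F(\mathbb R^d)$-interpolable if there is $f\in\mathcal F(\mathbb R^d)$ with $g_i\in\partial f(x_i)$ and $f_i=f(x_i)$ for all $i\in I$. With $e_k$ the canonical unit vectors, $\mathbf x_i,\mathbf g_i\in\mathbb R^{2N+2}$ and $\mathbf f_i\in\mathbb R^{N+2}$ are: $\mathbf x_0=0$, $\mathbf x_i=e_{N+1+i}$ ($1\le i\le N$), $\mathbf x_*=e_{2N+2}$, $\mathbf g_*=0$, $\mathbf g_i=e_{i+1}$ ($0\le i\le N$), $\mathbf f_i=e_{i+1}$ ($0\le i\le N$), $\mathbf f_*=e_{N+2}$. Encoding: $K_N$ is a finite index set, $A^{\mathrm{ic}}_k\in\mathbb R^{(2N+2)\times(2N+2)}$, $a^{\mathrm{ic}}_k\in\mathbb R^{N+2}$, $b^{\mathrm{ic}}_k\in\mathbb R$; they encode the interpolation conditions for $\mathcal F(\mathbb R^d)$ if, for any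 set $\{(x_i,g_i,f_i)\}_{i\in I^*_N}$ with $g_*=0$, setting $P=[g_0,\dots,g_N,\,x_1-x_0,\dots,x_N-x_0,\,x_*-x_0]$, $G=P^\top P$ and $F=[f_0,\dots,f_N,f_*]^\top$, the set is $\mathcal F(\mathbb R^d)$-interpolable if and only if $\mathrm{Tr}(A^{\mathrm{ic}}_kG)+(a^{\mathrm{ic}}_k)^\top F+b^{\mathrm{ic}}_k\le0$ for all $k\in K_N$. Problem (D): $$\begin{aligned}\inf\ &\ \tau_xR_x^2-\sum_{k\in K_N}\alpha_k b^{\mathrm{ic}}_k\\ \text{subject to: }&\ \alpha_k\ge 0,\quad \tau_x\ge 0,\\ &\ \sum_{k\in K_N}\alpha_kA^{\mathrm{ic}}_k+\sum_{i=1}^N \mathbf g_i\odot\Big[\sum_{j=0}^{i-1}\beta_{i,j}\mathbf g_j+\sum_{j=1}^{i}\gamma_{i,j}(\mathbf x_j-\mathbf x_0)\Big]+\tau_x\,(\mathbf x_0-\mathbf x_* )\odot(\mathbf x_0-\mathbf x_* )\succeq 0,\\ &\ \mathbf f_N-\mathbf f_*-\sum_{k\in K_N}\alpha_ka^{\mathrm{ic}}_k=0,\end{aligned}$$ with real variables $\alpha_k$ ($k\in K_N$), $\beta_{i,j}$ ($1\le i\le N$, $0\le j\le i-1$), $\gamma_{i,j}$ ($1\le i\le N$, $1\le j\le i$), $\tau_x$. *)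

theory Defs
  imports "HOL-Analysis.Analysis" "Jordan_Normal_Form.Matrix"
begin

text \<open>
  Two notions of vector are in play. Points of the Euclidean space are of type \<open>real ^ 'd\<close>
  and use \<open>inner\<close> and \<open>norm\<close>. The coefficient vectors and matrices, whose sizes
  \<open>2 * N + 2\<close> and \<open>N + 2\<close> depend on \<open>N\<close>, are the carrier-based
  \<open>real Matrix.vec\<close> and \<open>real mat\<close>; the infix dot is reserved for their \<open>scalar_prod\<close>.
\<close>

unbundle no inner_syntax

section \<open>Extended-real-valued functions\<close>

definition ereal_epigraph :: "('a \<Rightarrow> ereal) \<Rightarrow> ('a \<times> real) set" where
  "ereal_epigraph f = {(x, t). f x \<le> ereal t}"

definition closed_fun :: "('a::topological_space \<Rightarrow> ereal) \<Rightarrow> bool" where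
  "closed_fun f \<longleftrightarrow> closed (ereal_epigraph f)"

definition convex_fun :: "('a::real_vector \<Rightarrow> ereal) \<Rightarrow> bool" where
  "convex_fun f \<longleftrightarrow> convex (ereal_epigraph f)"

definition proper_fun :: "('a \<Rightarrow> ereal) \<Rightarrow> bool" where
  "proper_fun f \<longleftrightarrow> (\<forall>x. f x \<noteq> -\<infinity>) \<and> (\<exists>x. f x \<noteq> \<infinity>)"

text \<open>For a proper \<open>f\<close> the following set is empty at every \<open>x\<close> with \<open>f x = \<infinity>\<close>.\<close>

definition subdifferential :: "('a::real_inner \<Rightarrow> ereal) \<Rightarrow> 'a \<Rightarrow> 'a set" where
  "subdifferential f x = {g. \<forall>y. f x + ereal (inner g (y - x)) \<le> f y}"

definition argmin :: "('a \<Rightarrow> ereal) \<Rightarrow> 'a set" where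
  "argmin f = {x. is_arg_min f (\<lambda>_. True) x}"

text \<open>
  The infimum below is a minimum as soon as \<open>argmin f\<close> is nonempty, which \<open>is_input\<close> guarantees.
\<close>

definition min_value :: "('a \<Rightarrow> ereal) \<Rightarrow> ereal" where
  "min_value f = (INF x. f x)"

definition is_input ::
    "(real ^ 'd \<Rightarrow> ereal) set \<Rightarrow> real \<Rightarrow> (real ^ 'd \<Rightarrow> ereal) \<Rightarrow> real ^ 'd \<Rightarrow> bool" where
  "is_input \<F> R f x0 \<longleftrightarrow> f \<in> \<F> \<and> (\<exists>xs\<in>argmin f. norm (x0 - xs) \<le> R)"

section \<open>Interpolation\<close>

datatype idx = Star | Ix nat

definition star_indices :: "nat \<Rightarrow> idx set" where
  "star_indices N = insert Star (Ix ` {0..N})"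

definition interpolable ::
    "(real ^ 'd \<Rightarrow> ereal) set \<Rightarrow> 'i set \<Rightarrow> ('i \<Rightarrow> real ^ 'd) \<Rightarrow> ('i \<Rightarrow> real ^ 'd) \<Rightarrow> ('i \<Rightarrow> real)
      \<Rightarrow> bool" where
  "interpolable \<F> I x g v \<longleftrightarrow>
     (\<exists>f\<in>\<F>. \<forall>i\<in>I. g i \<in> subdifferential f (x i) \<and> f (x i) = ereal (v i))"

section \<open>Matrices\<close>

definition mat_trace :: "real mat \<Rightarrow> real" where
  "mat_trace M = (\<Sum>i<dim_row M. M $$ (i, i))"

definition psd :: "real mat \<Rightarrow> bool" where
  "psd M \<longleftrightarrow> square_mat M \<and> (\<forall>v\<in>carrier_vec (dim_row M). 0 \<le> v \<bullet> (M *\<^sub>v v))"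

definition outer_prod :: "real Matrix.vec \<Rightarrow> real Matrix.vec \<Rightarrow> real mat" where
  "outer_prod x y = mat_of_cols (dim_vec x) [x] * transpose_mat (mat_of_cols (dim_vec y) [y])"

definition sym_prod :: "real Matrix.vec \<Rightarrow> real Matrix.vec \<Rightarrow> real mat" (infixl \<open>\<odot>\<^sub>s\<close> 70) where
  "x \<odot>\<^sub>s y = (1 / 2) \<cdot>\<^sub>m (outer_prod x y + outer_prod y x)"

abbreviation vsum :: "nat \<Rightarrow> ('c \<Rightarrow> real Matrix.vec) \<Rightarrow> 'c set \<Rightarrow> real Matrix.vec" where
  "vsum n \<equiv> finsum_vec TYPE(real) n"

abbreviation msum :: "nat \<Rightarrow> ('c \<Rightarrow> real mat) \<Rightarrow> 'c set \<Rightarrow> real mat" where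
  "msum n \<equiv> finsum (module_mat TYPE(real) n n)"

section \<open>Encoding of interpolation conditions\<close>

text \<open>
  \<open>Pcols N x g\<close> lists the columns of \<open>P\<close>, and \<open>gram\<close> forms \<open>P\<^sup>T P\<close>,
  whose entries are the inner products of the columns of \<open>P\<close>.
\<close>

definition Pcols :: "nat \<Rightarrow> (idx \<Rightarrow> real ^ 'd) \<Rightarrow> (idx \<Rightarrow> real ^ 'd) \<Rightarrow> (real ^ 'd) list" where
  "Pcols N x g =
     map (\<lambda>i. g (Ix i)) [0..<N + 1] @ map (\<lambda>i. x (Ix i) - x (Ix 0)) [1..<N + 1]
       @ [x Star - x (Ix 0)]"

definition gram :: "(real ^ 'd) list \<Rightarrow> real mat" where
  "gram ps = Matrix.mat (length ps) (length ps) (\<lambda>(i, j). inner (ps ! i) (ps ! j))"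

definition Fvec :: "nat \<Rightarrow> (idx \<Rightarrow> real) \<Rightarrow> real Matrix.vec" where
  "Fvec N v = vec_of_list (map (\<lambda>i. v (Ix i)) [0..<N + 1] @ [v Star])"

definition encodes_interpolation ::
    "(real ^ 'd \<Rightarrow> ereal) set \<Rightarrow> nat \<Rightarrow> 'k set \<Rightarrow> ('k \<Rightarrow> real mat) \<Rightarrow> ('k \<Rightarrow> real Matrix.vec) \<Rightarrow> ('k \<Rightarrow> real)
      \<Rightarrow> bool" where
  "encodes_interpolation \<F> N K A a b \<longleftrightarrow>
     finite K \<and>
     (\<forall>k\<in>K. A k \<in> carrier_mat (2 * N + 2) (2 * N + 2) \<and> a k \<in> carrier_vec (N + 2)) \<and>
     (\<forall>(x :: idx \<Rightarrow> real ^ 'd) g v. g Star = 0 \<longrightarrow>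
        (interpolable \<F> (star_indices N) x g v \<longleftrightarrow>
         (\<forall>k\<in>K. mat_trace (A k * gram (Pcols N x g)) + a k \<bullet> Fvec N v + b k \<le> 0)))"

section \<open>The optimization problem\<close>

text \<open>
  Unit vectors of \<open>Matrix\<close> are indexed from 0, so the canonical unit vector usually
  written \<open>e\<^sub>k\<close> is \<open>unit_vec n (k - 1)\<close>.
\<close>

fun bold_x :: "nat \<Rightarrow> idx \<Rightarrow> real Matrix.vec" where
  "bold_x N (Ix i) = (if i = 0 then 0\<^sub>v (2 * N + 2) else unit_vec (2 * N + 2) (N + i))"
| "bold_x N Star = unit_vec (2 * N + 2) (2 * N + 1)"

fun bold_g :: "nat \<Rightarrow> idx \<Rightarrow> real Matrix.vec" where
  "bold_g N (Ix i) = unit_vec (2 * N + 2) i"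
| "bold_g N Star = 0\<^sub>v (2 * N + 2)"

fun bold_f :: "nat \<Rightarrow> idx \<Rightarrow> real Matrix.vec" where
  "bold_f N (Ix i) = unit_vec (N + 2) i"
| "bold_f N Star = unit_vec (N + 2) (N + 1)"

definition D_matrix ::
    "nat \<Rightarrow> 'k set \<Rightarrow> ('k \<Rightarrow> real mat) \<Rightarrow> ('k \<Rightarrow> real) \<Rightarrow> (nat \<Rightarrow> nat \<Rightarrow> real) \<Rightarrow> (nat \<Rightarrow> nat \<Rightarrow> real)
      \<Rightarrow> real \<Rightarrow> real mat" where
  "D_matrix N K A \<alpha> \<beta> \<gamma> \<tau> =
     msum (2 * N + 2) (\<lambda>k. \<alpha> k \<cdot>\<^sub>m A k) K
     + msum (2 * N + 2)
         (\<lambda>i. bold_g N (Ix i) \<odot>\<^sub>s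
            (vsum (2 * N + 2) (\<lambda>j. \<beta> i j \<cdot>\<^sub>v bold_g N (Ix j)) {0..<i}
             + vsum (2 * N + 2) (\<lambda>j. \<gamma> i j \<cdot>\<^sub>v (bold_x N (Ix j) - bold_x N (Ix 0))) {1..i}))
         {1..N}
     + \<tau> \<cdot>\<^sub>m ((bold_x N (Ix 0) - bold_x N Star) \<odot>\<^sub>s (bold_x N (Ix 0) - bold_x N Star))"

definition D_feasible ::
    "nat \<Rightarrow> 'k set \<Rightarrow> ('k \<Rightarrow> real mat) \<Rightarrow> ('k \<Rightarrow> real Matrix.vec) \<Rightarrow> ('k \<Rightarrow> real) \<Rightarrow> (nat \<Rightarrow> nat \<Rightarrow> real)
      \<Rightarrow> (nat \<Rightarrow> nat \<Rightarrow> real) \<Rightarrow> real \<Rightarrow> bool" where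
  "D_feasible N K A a \<alpha> \<beta> \<gamma> \<tau> \<longleftrightarrow>
     (\<forall>k\<in>K. 0 \<le> \<alpha> k) \<and> 0 \<le> \<tau> \<and>
     psd (D_matrix N K A \<alpha> \<beta> \<gamma> \<tau>) \<and>
     bold_f N (Ix N) - bold_f N Star - vsum (N + 2) (\<lambda>k. \<alpha> k \<cdot>\<^sub>v a k) K = 0\<^sub>v (N + 2)"

definition D_objective ::
    "real \<Rightarrow> 'k set \<Rightarrow> ('k \<Rightarrow> real) \<Rightarrow> ('k \<Rightarrow> real) \<Rightarrow> real \<Rightarrow> real" where
  "D_objective R K b \<alpha> \<tau> = \<tau> * R\<^sup>2 - (\<Sum>k\<in>K. \<alpha> k * b k)"

end

theory Submission
  imports Defs
begin

text \<open>
  The theorem is weak duality, with the gradients and displacements of the run as primal point.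
  The points \<open>x 0, \<dots>, x N\<close> and a minimizer \<open>xs\<close> within distance \<open>Rx\<close> of \<open>x 0\<close>, with the given subgradients and
  with \<open>0\<close> at \<open>xs\<close>, are interpolated by \<open>f\<close> itself, so each encoded inequality holds for
  their Gram matrix \<open>G\<close> and value vector \<open>F\<close>. Add these inequalities with the weights
  \<open>\<alpha> k \<ge> 0\<close>. By the linear constraint of the dual, the terms in \<open>F\<close> add up to
  \<open>f (x N) - f xs\<close>.

  It remains to bound the weighted sum of the \<open>mat_trace (A k * G)\<close> from below. The map
  \<open>M \<mapsto> mat_trace (M * G)\<close> is linear, sends a symmetric product \<open>u \<odot>\<^sub>s w\<close> to the inner
  product of the points whose coordinates with respect to the columns of \<open>P\<close> are \<open>u\<close> and
  \<open>w\<close> (\<open>gram_pairing_sym_prod\<close>), and is nonnegative on positive semidefinite matrices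
  (\<open>gram_pairing_psd\<close>). Applied to the matrix of the dual, it yields that sum, plus the inner
  products which the hypothesis on the \<open>x i\<close> makes vanish, plus \<open>\<tau> * (norm (x 0 - xs))\<^sup>2\<close>.
  The total is nonnegative, hence the sum is at least \<open>- \<tau> * Rx\<^sup>2\<close>. Together with the constants
  \<open>\<alpha> k * b k\<close> of the weighted inequalities, this is the bound by the dual objective.
\<close>

section \<open>Points given by coordinates\<close>

definition comb :: "(real ^ 'd) list \<Rightarrow> real Matrix.vec \<Rightarrow> real ^ 'd" where
  "comb ps u = (\<Sum>i<length ps. (u $ i) *\<^sub>R ps ! i)"

lemma comb_add:
  assumes "u \<in> carrier_vec (length ps)" "w \<in> carrier_vec (length ps)"
  shows "comb ps (u + w) = comb ps u + comb ps w"
  unfolding comb_def using assms by (simp add: scaleR_left_distrib sum.distrib)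

lemma comb_diff:
  assumes "u \<in> carrier_vec (length ps)" "w \<in> carrier_vec (length ps)"
  shows "comb ps (u - w) = comb ps u - comb ps w"
  unfolding comb_def using assms by (simp add: scaleR_left_diff_distrib sum_subtractf)

lemma comb_smult:
  assumes "u \<in> carrier_vec (length ps)"
  shows "comb ps (c \<cdot>\<^sub>v u) = c *\<^sub>R comb ps u"
  unfolding comb_def using assms by (simp add: scaleR_sum_right)

lemma comb_zero: "comb ps (0\<^sub>v (length ps)) = 0"
  unfolding comb_def by simp

lemma comb_unit:
  assumes "k < length ps"
  shows "comb ps (unit_vec (length ps) k) = ps ! k"
proof -
  have "comb ps (unit_vec (length ps) k) = (\<Sum>i<length ps. if i = k then ps ! i else 0)"
    unfolding comb_def by (rule sum.cong) (auto simp: assms)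
  then show ?thesis using assms by simp
qed

lemma comb_vsum:
  assumes "finite I" "\<And>i. i \<in> I \<Longrightarrow> u i \<in> carrier_vec (length ps)"
  shows "comb ps (vsum (length ps) u I) = (\<Sum>i\<in>I. comb ps (u i))"
  using assms
proof (induction I)
  case empty
  then show ?case by (simp add: comb_zero finsum_vec_empty)
next
  case (insert i I)
  then have "u \<in> I \<rightarrow> carrier_vec (length ps)" "u i \<in> carrier_vec (length ps)" by auto
  with insert show ?case by (simp add: finsum_vec_insert comb_add finsum_vec_closed)
qed

section \<open>Pairing a matrix with a Gram matrix\<close>

text \<open>The double sum makes linearity in the matrix evident.\<close>

lemma mat_trace_mult_gram:
  assumes "M \<in> carrier_mat (length ps) (length ps)"
  shows "mat_trace (M * gram ps) =
    (\<Sum>i<length ps. \<Sum>j<length ps. M $$ (i, j) * inner (ps ! i) (ps ! j))"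
  using assms
  by (auto simp: mat_trace_def gram_def scalar_prod_def lessThan_atLeast0 inner_commute
      intro!: sum.cong)

lemma gram_pairing_add:
  assumes "M \<in> carrier_mat (length ps) (length ps)" "L \<in> carrier_mat (length ps) (length ps)"
  shows "mat_trace ((M + L) * gram ps) = mat_trace (M * gram ps) + mat_trace (L * gram ps)"
  using assms by (simp add: mat_trace_mult_gram sum.distrib distrib_right)

lemma gram_pairing_smult:
  assumes "M \<in> carrier_mat (length ps) (length ps)"
  shows "mat_trace ((c \<cdot>\<^sub>m M) * gram ps) = c * mat_trace (M * gram ps)"
  using assms by (simp add: mat_trace_mult_gram sum_distrib_left mult.assoc)

lemma msum_closed:
  assumes "\<And>i. i \<in> I \<Longrightarrow> M i \<in> carrier_mat n n"
  shows "msum n M I \<in> carrier_mat n n"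
proof -
  interpret abelian_monoid "module_mat TYPE(real) n n"
    using abelian_group_mat abelian_group.axioms(1) by blast
  show ?thesis using finsum_closed[of M I] assms by (auto simp: module_mat_simps)
qed

lemma gram_pairing_msum:
  assumes "finite I" "\<And>i. i \<in> I \<Longrightarrow> M i \<in> carrier_mat (length ps) (length ps)"
  shows "mat_trace (msum (length ps) M I * gram ps) = (\<Sum>i\<in>I. mat_trace (M i * gram ps))"
  using assms
proof (induction I)
  interpret abelian_monoid "module_mat TYPE(real) (length ps) (length ps)"
    using abelian_group_mat abelian_group.axioms(1) by blast
  {
    case empty
    then show ?case by (simp add: module_mat_simps mat_trace_mult_gram)
  next
    case (insert i I)
    then have "msum (length ps) M (insert i I) = M i + msum (length ps) M I"
      using finsum_insert[of I i M] by (auto simp: module_mat_simps)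
    with insert show ?case by (simp add: gram_pairing_add msum_closed)
  }
qed

lemma outer_prod_carrier:
  assumes "u \<in> carrier_vec n" "w \<in> carrier_vec n"
  shows "outer_prod u w \<in> carrier_mat n n"
  using assms unfolding outer_prod_def by auto

lemma sym_prod_carrier:
  assumes "u \<in> carrier_vec n" "w \<in> carrier_vec n"
  shows "u \<odot>\<^sub>s w \<in> carrier_mat n n"
  using assms outer_prod_carrier unfolding sym_prod_def by auto

lemma outer_prod_index:
  assumes "u \<in> carrier_vec n" "w \<in> carrier_vec n" "i < n" "j < n"
  shows "outer_prod u w $$ (i, j) = u $ i * w $ j"
  using assms unfolding outer_prod_def by (auto simp: scalar_prod_def mat_of_cols_index)

lemma gram_pairing_outer_prod:
  assumes "u \<in> carrier_vec (length ps)" "w \<in> carrier_vec (length ps)"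
  shows "mat_trace (outer_prod u w * gram ps) = inner (comb ps u) (comb ps w)"
proof -
  have "inner (comb ps u) (comb ps w) =
      (\<Sum>i<length ps. \<Sum>j<length ps. u $ i * w $ j * inner (ps ! i) (ps ! j))"
    unfolding comb_def inner_sum_left by (simp add: inner_sum_right mult.left_commute mult.assoc)
  with assms show ?thesis
    by (simp add: mat_trace_mult_gram outer_prod_carrier outer_prod_index)
qed

lemma gram_pairing_sym_prod:
  assumes "u \<in> carrier_vec (length ps)" "w \<in> carrier_vec (length ps)"
  shows "mat_trace ((u \<odot>\<^sub>s w) * gram ps) = inner (comb ps u) (comb ps w)"
  using assms
  by (simp add: sym_prod_def gram_pairing_smult gram_pairing_add gram_pairing_outer_prod
      outer_prod_carrier inner_commute)

text \<open>
  A Gram matrix is a sum of squares: for each coordinate direction \<open>e\<close> of the Euclidean space,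
  the \<open>e\<close>-components of the points form a vector, and the pairing is the sum over \<open>e\<close> of
  the quadratic form of \<open>M\<close> at these vectors.
\<close>

lemma gram_pairing_psd:
  assumes M: "M \<in> carrier_mat (length ps) (length ps)" and "psd M"
  shows "0 \<le> mat_trace (M * gram ps)"
proof -
  define u where "u e = Matrix.vec (length ps) (\<lambda>i. inner (ps ! i) e)" for e
  have form: "u e \<bullet> (M *\<^sub>v u e) =
      (\<Sum>i<length ps. \<Sum>j<length ps. M $$ (i, j) * (inner (ps ! i) e * inner (ps ! j) e))" for e
    using M by (auto simp: u_def scalar_prod_def lessThan_atLeast0 sum_distrib_left
        mult_ac intro!: sum.cong)
  have "mat_trace (M * gram ps) = (\<Sum>i<length ps. \<Sum>j<length ps. \<Sum>e\<in>Basis.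
      M $$ (i, j) * (inner (ps ! i) e * inner (ps ! j) e))"
    using M by (simp add: mat_trace_mult_gram sum_distrib_left
        euclidean_inner[of "ps ! i" "ps ! j" for i j])
  also have "\<dots> = (\<Sum>i<length ps. \<Sum>e\<in>Basis. \<Sum>j<length ps.
      M $$ (i, j) * (inner (ps ! i) e * inner (ps ! j) e))"
    by (intro sum.cong refl sum.swap)
  also have "\<dots> = (\<Sum>e\<in>Basis. u e \<bullet> (M *\<^sub>v u e))"
    unfolding form by (rule sum.swap)
  also have "\<dots> \<ge> 0"
    using assms by (auto simp: psd_def u_def intro!: sum_nonneg)
  finally show ?thesis .
qed

section \<open>The columns of the Gram matrix\<close>

lemma length_Pcols: "length (Pcols N x g) = 2 * N + 2"
  by (simp add: Pcols_def)

lemma comb_bold_g: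
  assumes "i \<le> N"
  shows "comb (Pcols N x g) (bold_g N (Ix i)) = g (Ix i)"
proof -
  have "Pcols N x g ! i = g (Ix i)"
    using assms by (simp add: Pcols_def nth_append del: upt_Suc)
  with comb_unit[of i "Pcols N x g"] assms show ?thesis by (simp add: length_Pcols)
qed

lemma comb_bold_x:
  assumes "i \<le> N"
  shows "comb (Pcols N x g) (bold_x N (Ix i)) = x (Ix i) - x (Ix 0)"
proof (cases "i = 0")
  case True
  with comb_zero[of "Pcols N x g"] show ?thesis by (simp add: length_Pcols)
next
  case False
  with assms have "Pcols N x g ! (N + i) = x (Ix i) - x (Ix 0)"
    by (auto simp: Pcols_def nth_append simp del: upt_Suc)
  with comb_unit[of "N + i" "Pcols N x g"] assms False show ?thesis by (simp add: length_Pcols)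
qed

lemma comb_bold_x_Star: "comb (Pcols N x g) (bold_x N Star) = x Star - x (Ix 0)"
proof -
  have "Pcols N x g ! (2 * N + 1) = x Star - x (Ix 0)"
    by (simp add: Pcols_def nth_append del: upt_Suc)
  with comb_unit[of "2 * N + 1" "Pcols N x g"] show ?thesis by (simp add: length_Pcols)
qed

lemma bold_carrier:
  "bold_x N i \<in> carrier_vec (2 * N + 2)" "bold_g N i \<in> carrier_vec (2 * N + 2)"
  by (cases i; simp)+

text \<open>
  The pairing turns the matrix constraint of the dual, stated for formal vectors, into a statement
  about the actual points and subgradients.
\<close>

lemma gram_pairing_D_matrix:
  fixes x g :: "idx \<Rightarrow> real ^ 'd"
  assumes "finite K" and A: "\<And>k. k \<in> K \<Longrightarrow> A k \<in> carrier_mat (2 * N + 2) (2 * N + 2)"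
  shows "D_matrix N K A \<alpha> \<beta> \<gamma> \<tau> \<in> carrier_mat (2 * N + 2) (2 * N + 2)" (is ?carrier)
    and "mat_trace (D_matrix N K A \<alpha> \<beta> \<gamma> \<tau> * gram (Pcols N x g)) =
      (\<Sum>k\<in>K. \<alpha> k * mat_trace (A k * gram (Pcols N x g)))
      + (\<Sum>i=1..N. inner (g (Ix i)) ((\<Sum>j = 0..<i. \<beta> i j *\<^sub>R g (Ix j))
           + (\<Sum>j = 1..i. \<gamma> i j *\<^sub>R (x (Ix j) - x (Ix 0)))))
      + \<tau> * (norm (x (Ix 0) - x Star))\<^sup>2" (is ?trace)
proof -
  define n where "n = 2 * N + 2"
  define ps where "ps = Pcols N x g"
  have n: "length ps = n" unfolding n_def ps_def by (rule length_Pcols)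
  note carr = bold_carrier[of N, folded n_def]
  define B where "B i = vsum n (\<lambda>j. \<beta> i j \<cdot>\<^sub>v bold_g N (Ix j)) {0..<i}" for i
  define C where
    "C i = vsum n (\<lambda>j. \<gamma> i j \<cdot>\<^sub>v (bold_x N (Ix j) - bold_x N (Ix 0))) {1..i}" for i
  define S where "S i = bold_g N (Ix i) \<odot>\<^sub>s (B i + C i)" for i
  define y where "y = bold_x N (Ix 0) - bold_x N Star"
  have BC: "B i \<in> carrier_vec n" "C i \<in> carrier_vec n" for i
    unfolding B_def C_def
    by (auto intro!: finsum_vec_closed simp: carr simp del: bold_g.simps bold_x.simps)
  have y: "y \<in> carrier_vec n" unfolding y_def using carr by (simp del: bold_x.simps)
  have S: "S i \<in> carrier_mat n n" for i
    unfolding S_def using BC carr by (intro sym_prod_carrier) (auto simp del: bold_g.simps)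
  have \<alpha>A: "\<alpha> k \<cdot>\<^sub>m A k \<in> carrier_mat n n" if "k \<in> K" for k
    using A[OF that] by (simp add: n_def)
  have yy: "y \<odot>\<^sub>s y \<in> carrier_mat n n" using y by (intro sym_prod_carrier)
  have D: "D_matrix N K A \<alpha> \<beta> \<gamma> \<tau> =
      msum n (\<lambda>k. \<alpha> k \<cdot>\<^sub>m A k) K + msum n S {1..N} + \<tau> \<cdot>\<^sub>m (y \<odot>\<^sub>s y)"
    unfolding D_matrix_def S_def[abs_def] B_def C_def y_def n_def ..
  have sums: "msum n (\<lambda>k. \<alpha> k \<cdot>\<^sub>m A k) K \<in> carrier_mat n n" "msum n S {1..N} \<in> carrier_mat n n"
    using \<alpha>A S by (auto intro: msum_closed)
  show ?carrier
    unfolding D n_def[symmetric] using sums yy by auto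
  have combB: "comb ps (B i) = (\<Sum>j = 0..<i. \<beta> i j *\<^sub>R g (Ix j))" if "i \<le> N" for i
    unfolding B_def n[symmetric]
    using that carr
    by (subst comb_vsum) (auto simp: n comb_smult
        comb_bold_g[of _ N x g, folded ps_def] simp del: bold_g.simps intro!: sum.cong)
  have combC: "comb ps (C i) = (\<Sum>j = 1..i. \<gamma> i j *\<^sub>R (x (Ix j) - x (Ix 0)))" if "i \<le> N" for i
    unfolding C_def n[symmetric]
    using that carr
    by (subst comb_vsum) (auto simp: n comb_smult comb_diff
        comb_bold_x[of _ N x g, folded ps_def] simp del: bold_x.simps intro!: sum.cong)
  have comby: "comb ps y = x (Ix 0) - x Star"
    unfolding y_def using carr
    by (simp add: n comb_diff comb_bold_x[of 0 N x g, folded ps_def]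
        comb_bold_x_Star[of N x g, folded ps_def] del: bold_x.simps)
  have traceS: "mat_trace (S i * gram ps) = inner (g (Ix i)) ((\<Sum>j = 0..<i. \<beta> i j *\<^sub>R g (Ix j))
           + (\<Sum>j = 1..i. \<gamma> i j *\<^sub>R (x (Ix j) - x (Ix 0))))" if "i \<le> N" for i
    unfolding S_def using that BC carr
    by (simp add: n gram_pairing_sym_prod comb_add combB combC
        comb_bold_g[of _ N x g, folded ps_def] del: bold_g.simps)
  have "mat_trace (D_matrix N K A \<alpha> \<beta> \<gamma> \<tau> * gram ps) =
      mat_trace (msum n (\<lambda>k. \<alpha> k \<cdot>\<^sub>m A k) K * gram ps) + mat_trace (msum n S {1..N} * gram ps)
      + \<tau> * mat_trace ((y \<odot>\<^sub>s y) * gram ps)"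
    unfolding D using sums yy by (simp add: n gram_pairing_add gram_pairing_smult)
  also have "mat_trace (msum n (\<lambda>k. \<alpha> k \<cdot>\<^sub>m A k) K * gram ps)
      = (\<Sum>k\<in>K. \<alpha> k * mat_trace (A k * gram ps))"
    using gram_pairing_msum[of K "\<lambda>k. \<alpha> k \<cdot>\<^sub>m A k" ps] \<open>finite K\<close> \<alpha>A A[folded n_def]
    by (simp add: n gram_pairing_smult)
  also have "mat_trace (msum n S {1..N} * gram ps) = (\<Sum>i=1..N. mat_trace (S i * gram ps))"
    using gram_pairing_msum[of "{1..N}" S ps] S by (simp add: n)
  also have "mat_trace ((y \<odot>\<^sub>s y) * gram ps) = (norm (x (Ix 0) - x Star))\<^sup>2"
    using y by (simp add: n gram_pairing_sym_prod comby power2_norm_eq_inner)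
  finally show ?trace
    unfolding ps_def[symmetric] by (simp add: traceS)
qed

section \<open>The vector of function values\<close>

lemma Fvec_carrier: "Fvec N v \<in> carrier_vec (N + 2)"
  unfolding Fvec_def by (rule carrier_vecI) simp

lemma bold_f_scalar_prod_Fvec:
  "bold_f N (Ix N) \<bullet> Fvec N v = v (Ix N)" "bold_f N Star \<bullet> Fvec N v = v Star"
proof -
  have "Fvec N v $ N = v (Ix N)" "Fvec N v $ (N + 1) = v Star"
    by (auto simp: Fvec_def vec_of_list_index nth_append simp del: upt_Suc)
  then show "bold_f N (Ix N) \<bullet> Fvec N v = v (Ix N)" "bold_f N Star \<bullet> Fvec N v = v Star"
    using Fvec_carrier[of N v] by simp_all
qed

lemma vsum_scalar_prod:
  assumes "finite I" "\<And>i. i \<in> I \<Longrightarrow> u i \<in> carrier_vec n" "w \<in> carrier_vec n"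
  shows "vsum n u I \<bullet> w = (\<Sum>i\<in>I. u i \<bullet> w)"
  using assms
proof (induction I)
  case empty
  then show ?case by (simp add: finsum_vec_empty)
next
  case (insert i I)
  then have "u \<in> I \<rightarrow> carrier_vec n" "u i \<in> carrier_vec n" by auto
  with insert show ?case
    by (simp add: finsum_vec_insert add_scalar_prod_distrib[of _ n] finsum_vec_closed)
qed

text \<open>
  The linear constraint of the dual says that the weighted vectors \<open>a k\<close> cancel all values but
  the last iterate's and the minimum, so the weighted inequalities speak of the gap alone.
\<close>

lemma weighted_values:
  assumes "finite K" and a: "\<And>k. k \<in> K \<Longrightarrow> a k \<in> carrier_vec (N + 2)"
    and eq: "bold_f N (Ix N) - bold_f N Star - vsum (N + 2) (\<lambda>k. \<alpha> k \<cdot>\<^sub>v a k) K = 0\<^sub>v (N + 2)"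
  shows "(\<Sum>k\<in>K. \<alpha> k * (a k \<bullet> Fvec N v)) = v (Ix N) - v Star"
proof -
  let ?s = "vsum (N + 2) (\<lambda>k. \<alpha> k \<cdot>\<^sub>v a k) K"
  let ?d = "bold_f N (Ix N) - bold_f N Star"
  have s: "?s \<in> carrier_vec (N + 2)" using a by (intro finsum_vec_closed) auto
  have bf: "bold_f N (Ix N) \<in> carrier_vec (N + 2)" "bold_f N Star \<in> carrier_vec (N + 2)"
    by auto
  have "(?d - ?s) \<bullet> Fvec N v = ?d \<bullet> Fvec N v - ?s \<bullet> Fvec N v"
    using s bf Fvec_carrier[of N v] by (intro minus_scalar_prod_distrib) auto
  moreover have "?d \<bullet> Fvec N v = v (Ix N) - v Star"
    using bf Fvec_carrier[of N v] bold_f_scalar_prod_Fvec[of N v]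
    by (subst minus_scalar_prod_distrib[of _ "N + 2"]) (auto simp del: bold_f.simps)
  moreover have "(?d - ?s) \<bullet> Fvec N v = 0"
    unfolding eq using Fvec_carrier[of N v] by simp
  moreover have "?s \<bullet> Fvec N v = (\<Sum>k\<in>K. \<alpha> k * (a k \<bullet> Fvec N v))"
    using \<open>finite K\<close> a Fvec_carrier[of N v]
    by (subst vsum_scalar_prod) (auto intro!: sum.cong)
  ultimately show ?thesis by simp
qed

section \<open>Finiteness of the values\<close>

lemma subdifferential_imp_finite:
  assumes "proper_fun f" "g \<in> subdifferential f x"
  shows "\<bar>f x\<bar> \<noteq> \<infinity>"
proof -
  from assms(1) obtain y where "f y \<noteq> \<infinity>" by (auto simp: proper_fun_def)
  moreover from assms(2) have "f x + ereal (inner g (y - x)) \<le> f y"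
    by (auto simp: subdifferential_def)
  ultimately have "f x \<noteq> \<infinity>" by auto
  with assms(1) show ?thesis by (auto simp: proper_fun_def)
qed

lemma argmin_le:
  assumes "x \<in> argmin f"
  shows "f x \<le> f y"
  using assms by (auto simp: argmin_def is_arg_min_def not_less)

lemma zero_in_subdifferential_argmin:
  assumes "x \<in> argmin f"
  shows "0 \<in> subdifferential f x"
  using argmin_le[OF assms] by (simp add: subdifferential_def zero_ereal_def[symmetric])

lemma min_value_argmin:
  assumes "x \<in> argmin f"
  shows "min_value f = f x"
  unfolding min_value_def using argmin_le[OF assms] by (auto intro!: antisym INF_lower INF_greatest)

section \<open>Weak duality\<close>

theorem theorem4:
  fixes N :: nat and Rx :: real
    and \<F> :: "(real ^ 'd \<Rightarrow> ereal) set"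
    and K :: "'k set" and A :: "'k \<Rightarrow> real mat" and a :: "'k \<Rightarrow> real Matrix.vec" and b :: "'k \<Rightarrow> real"
    and \<alpha> :: "'k \<Rightarrow> real" and \<beta> \<gamma> :: "nat \<Rightarrow> nat \<Rightarrow> real" and \<tau> \<omega> :: real
    and f :: "real ^ 'd \<Rightarrow> ereal" and x f' :: "nat \<Rightarrow> real ^ 'd"
  assumes "1 \<le> N" and "0 \<le> Rx"
    and "\<And>h. h \<in> \<F> \<Longrightarrow> closed_fun h \<and> convex_fun h \<and> proper_fun h"
    and "encodes_interpolation \<F> N K A a b"
    and "D_feasible N K A a \<alpha> \<beta> \<gamma> \<tau>"
    and "D_objective Rx K b \<alpha> \<tau> = \<omega>"
    and "is_input \<F> Rx f (x 0)"
    and "\<And>i. i \<in> {0..N} \<Longrightarrow> f' i \<in> subdifferential f (x i)"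
    and "\<And>i. i \<in> {1..N} \<Longrightarrow>
           inner (f' i) ((\<Sum>j = 0..<i. \<beta> i j *\<^sub>R f' j) + (\<Sum>j = 1..i. \<gamma> i j *\<^sub>R (x j - x 0))) = 0"
  shows "f (x N) - min_value f \<le> ereal \<omega>"
proof -
  from assms(7) obtain xs where f: "f \<in> \<F>" and xs: "xs \<in> argmin f" "norm (x 0 - xs) \<le> Rx"
    by (auto simp: is_input_def)
  from f assms(3) have proper: "proper_fun f" by blast
  define X where "X i = (case i of Star \<Rightarrow> xs | Ix j \<Rightarrow> x j)" for i
  define g where "g i = (case i of Star \<Rightarrow> 0 | Ix j \<Rightarrow> f' j)" for i
  define v where "v i = real_of_ereal (f (X i))" for i
  have X [simp]: "X Star = xs" "\<And>j. X (Ix j) = x j" by (simp_all add: X_def)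
  have g [simp]: "g Star = 0" "\<And>j. g (Ix j) = f' j" by (simp_all add: g_def)
  have sub: "g i \<in> subdifferential f (X i)" if "i \<in> star_indices N" for i
    using that assms(8) zero_in_subdifferential_argmin[OF xs(1)] by (auto simp: star_indices_def)
  have val: "f (X i) = ereal (v i)" if "i \<in> star_indices N" for i
    unfolding v_def using subdifferential_imp_finite[OF proper sub[OF that]]
    by (simp add: ereal_real')
  from f sub val have "interpolable \<F> (star_indices N) X g v"
    unfolding interpolable_def by blast
  moreover let ?G = "gram (Pcols N X g)"
  from assms(4) have K: "finite K"
    and A: "\<And>k. k \<in> K \<Longrightarrow> A k \<in> carrier_mat (2 * N + 2) (2 * N + 2)"
    and a: "\<And>k. k \<in> K \<Longrightarrow> a k \<in> carrier_vec (N + 2)"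
    unfolding encodes_interpolation_def by blast+
  ultimately have ic: "mat_trace (A k * ?G) + a k \<bullet> Fvec N v + b k \<le> 0" if "k \<in> K" for k
    using assms(4) that g(1) unfolding encodes_interpolation_def by blast
  from assms(5) have \<alpha>: "\<And>k. k \<in> K \<Longrightarrow> 0 \<le> \<alpha> k" and \<tau>: "0 \<le> \<tau>"
    and psd: "psd (D_matrix N K A \<alpha> \<beta> \<gamma> \<tau>)"
    and eq: "bold_f N (Ix N) - bold_f N Star - vsum (N + 2) (\<lambda>k. \<alpha> k \<cdot>\<^sub>v a k) K = 0\<^sub>v (N + 2)"
    unfolding D_feasible_def by blast+
  have "(\<Sum>k\<in>K. \<alpha> k * (mat_trace (A k * ?G) + a k \<bullet> Fvec N v + b k)) \<le> 0"
    using \<alpha> ic by (intro sum_nonpos mult_nonneg_nonpos)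
  then have weighted: "(\<Sum>k\<in>K. \<alpha> k * mat_trace (A k * ?G)) + (v (Ix N) - v Star)
      + (\<Sum>k\<in>K. \<alpha> k * b k) \<le> 0"
    using weighted_values[OF K a eq, of v] by (simp add: distrib_left sum.distrib)
  have "0 \<le> mat_trace (D_matrix N K A \<alpha> \<beta> \<gamma> \<tau> * ?G)"
    using gram_pairing_D_matrix(1)[OF K A] psd by (intro gram_pairing_psd) (simp_all add: length_Pcols)
  also have "\<dots> = (\<Sum>k\<in>K. \<alpha> k * mat_trace (A k * ?G)) + \<tau> * (norm (x 0 - xs))\<^sup>2"
    using gram_pairing_D_matrix(2)[OF K A, where x = X and g = g] assms(9) by simp
  finally have "0 \<le> (\<Sum>k\<in>K. \<alpha> k * mat_trace (A k * ?G)) + \<tau> * (norm (x 0 - xs))\<^sup>2" .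
  moreover have "\<tau> * (norm (x 0 - xs))\<^sup>2 \<le> \<tau> * Rx\<^sup>2"
    using \<tau> xs(2) by (intro mult_left_mono power_mono) auto
  ultimately have "v (Ix N) - v Star \<le> \<omega>"
    using weighted assms(6) unfolding D_objective_def by linarith
  moreover have "f (x N) = ereal (v (Ix N))" "min_value f = ereal (v Star)"
    using val[of "Ix N"] val[of Star] min_value_argmin[OF xs(1)] by (auto simp: star_indices_def)
  ultimately show ?thesis by simp
qed

end
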